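(* Let $r$ be a positive integer, let $s,t$ be integers with $0\le s,t\le r-1$, and let $h$ be a positive integer with $r<\phi^h$. Then there exists a Hofstadter G pair $(u,v)$ with $u\equiv s\pmod r$, $v\equiv t\pmod r$, and $v\le F_{2h+2}-2$.
   Context: $F_0=0$, $F_1=1$, $F_i=F_{i-1}+F_{i-2}$ are the Fibonacci numbers and $\phi=(1+\sqrt5)/2$. Hofstadter's G function is $G(x)=\lfloor\phi^{-1}(x+1)\rfloor$ for integers $x\ge0$ (equivalently $G(0)=0$, $G(1)=1$, $G(x)=x-G(G(x-1))$). A Hofstadter G pair is a pair $(u,v)$ of positive integers with $u=G(v)$. *)

theory Defs
  imports "HOL-Number_Theory.Number_Theory"
begin

definition golden_ratio :: real where
  "golden_ratio = (1 + sqrt 5) / 2"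

definition hofstadter_G :: "nat \<Rightarrow> nat" where
  "hofstadter_G x = nat \<lfloor>inverse golden_ratio * (real x + 1)\<rfloor>"

definition hofstadter_G_pair :: "nat \<Rightarrow> nat \<Rightarrow> bool" where
  "hofstadter_G_pair u v \<longleftrightarrow> u > 0 \<and> v > 0 \<and> u = hofstadter_G v"

end

theory Submission
  imports Defs
begin

text \<open>
  Write \<open>\<phi>\<close> for the golden ratio. A pair \<open>(u, v)\<close> satisfies \<open>u = G v\<close> as soon as
  \<open>-1 < v - \<phi> u < \<phi> - 1\<close>. For \<open>u = s + r a\<close> and \<open>v = t + r b\<close> this asks that \<open>b - \<phi> a\<close> lie in an
  open interval of length \<open>\<phi> / r > \<phi> / \<phi> ^ h\<close>. Since \<open>F (n+1) - \<phi> F n = (-1/\<phi>) ^ n\<close>, an induction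
  on \<open>h\<close> shows that every half-open interval of length \<open>\<phi> / \<phi> ^ h\<close> contains such a number with
  \<open>0 \<le> a < F (h+1)\<close>, so that \<open>u < r F (h+1)\<close> and hence \<open>v < r F (h+2)\<close>. Being an integer, \<open>r\<close> is at
  most the Lucas number \<open>L h = \<phi> ^ h + (-1/\<phi>) ^ h\<close>, and \<open>L h F (h+2) = F (2h+2) + (-1) ^ h\<close>.
  The class \<open>s = t = 0\<close> might yield \<open>u = v = 0\<close>; there \<open>r\<close> times a pair of consecutive Fibonacci
  numbers is used instead.
\<close>

lemma golden_ratio_bounds: "1 < golden_ratio" "golden_ratio < 2"
proof -
  have "1 < sqrt (5::real)" "sqrt (5::real) < 3"
    by (simp_all add: real_less_rsqrt real_less_lsqrt)
  then show "1 < golden_ratio" "golden_ratio < 2"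
    by (simp_all add: golden_ratio_def)
qed

lemma golden_ratio_square: "golden_ratio * golden_ratio = golden_ratio + 1"
  by (simp add: golden_ratio_def field_simps)

lemma inverse_golden_ratio: "inverse golden_ratio = golden_ratio - 1"
  by (rule inverse_unique) (simp add: golden_ratio_square algebra_simps)

lemma neg_inverse_golden_ratio_square:
  "- inverse golden_ratio * - inverse golden_ratio = - inverse golden_ratio + 1"
  unfolding inverse_golden_ratio by (simp add: golden_ratio_square algebra_simps)

lemma power_Suc_Suc_if_square_eq:
  fixes x :: "'a :: comm_semiring_1"
  assumes "x * x = x + 1"
  shows "x ^ Suc (Suc n) = x ^ Suc n + x ^ n"
proof -
  have "x ^ Suc (Suc n) = x * x * x ^ n"
    by (simp add: mult.assoc)
  then show ?thesis
    by (simp add: assms distrib_right)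
qed

lemma inverse_golden_ratio_power_bounds:
  "0 < inverse golden_ratio ^ n" "inverse golden_ratio ^ n \<le> 1"
  using golden_ratio_bounds by (simp_all add: power_le_one inverse_le_1_iff)

lemma golden_ratio_mult_inverse_power:
  "golden_ratio * inverse golden_ratio ^ n = inverse golden_ratio ^ n + inverse golden_ratio ^ Suc n"
proof -
  have "golden_ratio * inverse golden_ratio ^ n = (1 + inverse golden_ratio) * inverse golden_ratio ^ n"
    by (simp add: inverse_golden_ratio)
  then show ?thesis
    by (simp add: distrib_right)
qed

lemma mult_inverse_golden_ratio_power_less_1:
  "r < golden_ratio ^ n \<Longrightarrow> r * inverse golden_ratio ^ n < 1"
  using golden_ratio_bounds by (simp add: field_simps)

lemma fib_golden_ratio:
  "real (fib n) = (golden_ratio ^ n - (- inverse golden_ratio) ^ n) / sqrt 5"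
proof -
  have "(1 - sqrt 5) / 2 = - inverse golden_ratio"
    unfolding inverse_golden_ratio by (simp add: golden_ratio_def field_simps)
  then show ?thesis
    using fib_closed_form[of n] by (simp flip: golden_ratio_def)
qed

lemma fib_Suc_diff_golden_ratio:
  "real (fib (Suc n)) - golden_ratio * real (fib n) = (- inverse golden_ratio) ^ n"
proof -
  define \<psi> where "\<psi> = - inverse golden_ratio"
  have "golden_ratio - \<psi> = sqrt 5"
    unfolding \<psi>_def inverse_golden_ratio by (simp add: golden_ratio_def field_simps)
  then have "(golden_ratio - \<psi>) * \<psi> ^ n / sqrt 5 = \<psi> ^ n"
    by simp
  then show ?thesis
    unfolding fib_golden_ratio \<psi>_def[symmetric] by (simp add: diff_divide_distrib algebra_simps)
qed

fun lucas :: "nat \<Rightarrow> nat" where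
  "lucas 0 = 2"
| "lucas (Suc 0) = 1"
| "lucas (Suc (Suc n)) = lucas (Suc n) + lucas n"

lemma lucas_golden_ratio:
  "real (lucas n) = golden_ratio ^ n + (- inverse golden_ratio) ^ n"
proof (induction n rule: lucas.induct)
  case 2
  show ?case
    by (simp add: inverse_golden_ratio)
next
  case (3 n)
  then show ?case
    unfolding power_Suc_Suc_if_square_eq[OF golden_ratio_square]
      power_Suc_Suc_if_square_eq[OF neg_inverse_golden_ratio_square] by simp
qed simp

lemma fib_mult_lucas:
  "int (fib (n + k)) * int (lucas n) = int (fib (2 * n + k)) + (- 1) ^ n * int (fib k)"
proof -
  define \<psi> where "\<psi> = - inverse golden_ratio"
  have "golden_ratio ^ n * \<psi> ^ n = (- 1) ^ n"
    using golden_ratio_bounds by (simp add: \<psi>_def flip: power_mult_distrib)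
  then have "(golden_ratio ^ (n + k) - \<psi> ^ (n + k)) * (golden_ratio ^ n + \<psi> ^ n)
      = (golden_ratio ^ (2 * n + k) - \<psi> ^ (2 * n + k)) + (- 1) ^ n * (golden_ratio ^ k - \<psi> ^ k)"
    by (simp add: power_add power_mult power2_eq_square mult_2 algebra_simps)
  then have "real (fib (n + k)) * real (lucas n)
      = real (fib (2 * n + k)) + (- 1) ^ n * real (fib k)"
    by (simp add: fib_golden_ratio lucas_golden_ratio \<psi>_def divide_simps)
  then have "real_of_int (int (fib (n + k)) * int (lucas n))
      = real_of_int (int (fib (2 * n + k)) + (- 1) ^ n * int (fib k))"
    by simp
  then show ?thesis
    by (simp only: of_int_eq_iff)
qed

lemma le_lucas_if_odd: "odd n \<Longrightarrow> real r < golden_ratio ^ n \<Longrightarrow> r \<le> lucas n"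
  using lucas_golden_ratio[of n] inverse_golden_ratio_power_bounds[of n] by simp

lemma less_lucas_if_even: "even n \<Longrightarrow> real r < golden_ratio ^ n \<Longrightarrow> r < lucas n"
  using lucas_golden_ratio[of n] inverse_golden_ratio_power_bounds[of n] by simp

lemma mult_fib_less_if_odd:
  assumes "odd n" "real r < golden_ratio ^ n"
  shows "r * fib (n + 2) < fib (2 * n + 2)"
proof -
  have "int (lucas n * fib (n + 2) + 1) = int (fib (2 * n + 2))"
    using fib_mult_lucas[of n 2] \<open>odd n\<close> by (simp add: mult.commute)
  moreover have "r * fib (n + 2) \<le> lucas n * fib (n + 2)"
    using le_lucas_if_odd assms by (intro mult_right_mono) auto
  ultimately show ?thesis
    by linarith
qed

lemma mult_fib_add_2_le_if_even:
  assumes "even n" "n > 0" "real r < golden_ratio ^ n"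
  shows "r * fib (n + 2) + 2 \<le> fib (2 * n + 2)"
proof -
  have "int (lucas n * fib (n + 2)) = int (fib (2 * n + 2) + 1)"
    using fib_mult_lucas[of n 2] \<open>even n\<close> by (simp add: mult.commute)
  moreover have "Suc r * fib (n + 2) \<le> lucas n * fib (n + 2)"
    using less_lucas_if_even[of n r] assms by (intro mult_right_mono) simp_all
  moreover have "fib 4 \<le> fib (n + 2)"
    using assms by (intro fib_mono) presburger
  moreover have "fib 4 = 3"
    by (simp add: numeral_eq_Suc)
  ultimately show ?thesis
    unfolding mult_Suc by linarith
qed

lemma mult_fib_less_fib:
  assumes "n > 0" "real r < golden_ratio ^ n"
  shows "r * fib (n + 2) < fib (2 * n + 2)"
  using mult_fib_less_if_odd[of n r] mult_fib_add_2_le_if_even[of n r] assms by linarith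

definition golden_ratio_deviations :: "nat \<Rightarrow> real set" where
  "golden_ratio_deviations m = {of_int b - golden_ratio * real a | a b. a < m}"

lemma golden_ratio_deviations_mono:
  "m \<le> n \<Longrightarrow> golden_ratio_deviations m \<subseteq> golden_ratio_deviations n"
  unfolding golden_ratio_deviations_def by fastforce

lemma golden_ratio_deviations_fib_shift:
  assumes "x \<in> golden_ratio_deviations (fib (Suc n))"
  shows "x + (- inverse golden_ratio) ^ n \<in> golden_ratio_deviations (fib (Suc (Suc n)))"
proof -
  obtain a b where x_eq: "x = of_int b - golden_ratio * real a" and "a < fib (Suc n)"
    using assms unfolding golden_ratio_deviations_def by blast
  have "x + (- inverse golden_ratio) ^ n
      = of_int (b + int (fib (Suc n))) - golden_ratio * real (a + fib n)"
    unfolding x_eq fib_Suc_diff_golden_ratio[symmetric] by (simp add: algebra_simps)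
  moreover have "a + fib n < fib (Suc (Suc n))"
    using \<open>a < fib (Suc n)\<close> by simp
  ultimately show ?thesis
    unfolding golden_ratio_deviations_def by blast
qed

lemma golden_ratio_deviations_fib_gap:
  "\<exists>x \<in> golden_ratio_deviations (fib (Suc n)).
     y < x \<and> x \<le> y + golden_ratio * inverse golden_ratio ^ n"
proof (induction n arbitrary: y)
  case 0
  have "of_int (\<lfloor>y\<rfloor> + 1) - golden_ratio * real 0 \<in> golden_ratio_deviations (fib (Suc 0))"
    unfolding golden_ratio_deviations_def by fastforce
  moreover have "y < of_int (\<lfloor>y\<rfloor> + 1)" "of_int (\<lfloor>y\<rfloor> + 1) \<le> y + golden_ratio"
    using golden_ratio_bounds by linarith+
  ultimately show ?case
    by (metis diff_zero mult.right_neutral mult_zero_right of_nat_0 power_0)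
next
  case (Suc n)
  define d e where "d = inverse golden_ratio ^ n" and "e = inverse golden_ratio ^ Suc n"
  have target_length: "golden_ratio * inverse golden_ratio ^ Suc n = d"
    using golden_ratio_bounds by (simp add: d_def)
  have extended_length: "golden_ratio * inverse golden_ratio ^ n = d + e"
    unfolding d_def e_def by (rule golden_ratio_mult_inverse_power)
  have "0 < e" "e \<le> d"
    unfolding d_def e_def using inverse_golden_ratio_power_bounds[of 1]
    by (simp_all add: mult_left_le_one_le inverse_golden_ratio_power_bounds)
  \<comment> \<open>extends the target interval on the side from which adding \<open>(-1/\<phi>) ^ n\<close> leads back into it\<close>
  define z where "z = (if odd n then y else y - e)"
  obtain x where x_in: "x \<in> golden_ratio_deviations (fib (Suc n))" and "z < x" "x \<le> z + (d + e)"
    using Suc[of z] unfolding extended_length by blast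
  define x' where "x' = x + (- inverse golden_ratio) ^ n"
  have "x' = (if odd n then x - d else x + d)"
    by (simp add: x'_def d_def)
  then have "y < x \<and> x \<le> y + d \<or> y < x' \<and> x' \<le> y + d"
    using \<open>z < x\<close> \<open>x \<le> z + (d + e)\<close> \<open>0 < e\<close> \<open>e \<le> d\<close> by (auto simp: z_def split: if_splits)
  moreover have "x \<in> golden_ratio_deviations (fib (Suc (Suc n)))"
    using x_in golden_ratio_deviations_mono[OF fib_Suc_mono] by blast
  moreover have "x' \<in> golden_ratio_deviations (fib (Suc (Suc n)))"
    unfolding x'_def by (rule golden_ratio_deviations_fib_shift[OF x_in])
  ultimately show ?case
    unfolding target_length by blast
qed

lemma mult_golden_ratio_deviations_fib_gap:
  assumes "0 < r" "r < golden_ratio ^ n"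
  shows "\<exists>x \<in> golden_ratio_deviations (fib (Suc n)). y < r * x \<and> r * x < y + golden_ratio"
proof -
  obtain x where "x \<in> golden_ratio_deviations (fib (Suc n))" and "y / r < x"
    and x_le: "x \<le> y / r + golden_ratio * inverse golden_ratio ^ n"
    using golden_ratio_deviations_fib_gap by blast
  have "r * x \<le> r * (y / r + golden_ratio * inverse golden_ratio ^ n)"
    using x_le \<open>0 < r\<close> by (intro mult_left_mono) auto
  also have "\<dots> = y + golden_ratio * (r * inverse golden_ratio ^ n)"
    using \<open>0 < r\<close> by (simp add: distrib_left)
  also have "\<dots> < y + golden_ratio * 1"
    using mult_inverse_golden_ratio_power_less_1[OF assms(2)] golden_ratio_bounds
    by (intro add_strict_left_mono mult_strict_left_mono) auto
  finally have "r * x < y + golden_ratio"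
    by simp
  moreover have "y < r * x"
    using \<open>y / r < x\<close> \<open>0 < r\<close> by (simp add: field_simps)
  ultimately show ?thesis
    using \<open>x \<in> golden_ratio_deviations (fib (Suc n))\<close> by blast
qed

lemma hofstadter_G_eq_iff:
  "hofstadter_G v = u \<longleftrightarrow>
     - 1 \<le> real v - golden_ratio * real u \<and> real v - golden_ratio * real u < golden_ratio - 1"
proof -
  have "0 \<le> \<lfloor>inverse golden_ratio * (real v + 1)\<rfloor>"
    using golden_ratio_bounds by simp
  then have "hofstadter_G v = u \<longleftrightarrow> \<lfloor>inverse golden_ratio * (real v + 1)\<rfloor> = int u"
    by (auto simp: hofstadter_G_def)
  also have "\<dots> \<longleftrightarrow>
     - 1 \<le> real v - golden_ratio * real u \<and> real v - golden_ratio * real u < golden_ratio - 1"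
    using golden_ratio_bounds by (simp add: floor_eq_iff field_simps)
  finally show ?thesis .
qed

lemma hofstadter_G_nat_eqI:
  assumes "- 1 < of_int k - golden_ratio * real u" "of_int k - golden_ratio * real u < golden_ratio - 1"
  shows "0 \<le> k" and "hofstadter_G (nat k) = u"
proof -
  have "0 \<le> golden_ratio * real u"
    using golden_ratio_bounds by simp
  then show "0 \<le> k"
    using assms(1) by linarith
  then show "hofstadter_G (nat k) = u"
    unfolding hofstadter_G_eq_iff using assms by simp
qed

lemma hofstadter_G_pos_iff: "0 < hofstadter_G v \<longleftrightarrow> 0 < v"
proof -
  have "hofstadter_G v = 0 \<longleftrightarrow> real v < golden_ratio - 1"
    using hofstadter_G_eq_iff[of v 0] by simp
  also have "\<dots> \<longleftrightarrow> v = 0"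
    using golden_ratio_bounds by linarith
  finally show ?thesis
    by (simp only: flip: neq0_conv)
qed

lemma mult_fib_Suc_diff_golden_ratio:
  "real (r * fib (Suc n)) - golden_ratio * real (r * fib n) = real r * (- inverse golden_ratio) ^ n"
  unfolding fib_Suc_diff_golden_ratio[symmetric] by (simp add: algebra_simps)

lemma hofstadter_G_mult_fib:
  assumes "odd n" "real r < golden_ratio ^ n"
  shows "hofstadter_G (r * fib (Suc n)) = r * fib n"
proof -
  have "real (r * fib (Suc n)) - golden_ratio * real (r * fib n)
      = - (real r * inverse golden_ratio ^ n)"
    unfolding mult_fib_Suc_diff_golden_ratio using \<open>odd n\<close> by simp
  moreover have "0 \<le> real r * inverse golden_ratio ^ n"
    using inverse_golden_ratio_power_bounds[of n] by simp
  ultimately show ?thesis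
    using mult_inverse_golden_ratio_power_less_1[OF assms(2)] golden_ratio_bounds(1)
    unfolding hofstadter_G_eq_iff by linarith
qed

lemma less_mult_fib_if_hofstadter_G_less:
  assumes "hofstadter_G v < r * fib n" "real r < golden_ratio ^ n"
  shows "v < r * fib (Suc n)"
proof -
  define u where "u = hofstadter_G v"
  have "real u + 1 \<le> real (r * fib n)"
    using assms(1) unfolding u_def by linarith
  then have "golden_ratio * (real u + 1) \<le> golden_ratio * real (r * fib n)"
    using golden_ratio_bounds by (intro mult_left_mono) auto
  moreover have "real v - golden_ratio * real u < golden_ratio - 1"
    using hofstadter_G_eq_iff[of v u] by (simp add: u_def)
  moreover have "- 1 < real r * (- inverse golden_ratio) ^ n"
  proof -
    have "\<bar>real r * (- inverse golden_ratio) ^ n\<bar> = real r * inverse golden_ratio ^ n"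
      using golden_ratio_bounds by (simp add: abs_mult power_abs)
    then show ?thesis
      using mult_inverse_golden_ratio_power_less_1[OF assms(2)] by linarith
  qed
  ultimately have "real v < real (r * fib (Suc n))"
    using mult_fib_Suc_diff_golden_ratio[of r n] by (simp add: distrib_left)
  then show ?thesis
    by (simp only: of_nat_less_iff)
qed

lemma hofstadter_G_residues:
  fixes s t :: int
  assumes "r > 0" "real r < golden_ratio ^ n"
  shows "\<exists>v. [int (hofstadter_G v) = s] (mod int r) \<and> [int v = t] (mod int r) \<and>
           hofstadter_G v < r * fib (Suc n)"
proof -
  define s' where "s' = nat (s mod int r)"
  have s'_eq: "int s' = s mod int r" and "s' < r"
    using \<open>r > 0\<close> by (simp_all add: s'_def nat_less_iff)
  define y where "y = golden_ratio * real s' - of_int t - 1"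
  obtain x where "x \<in> golden_ratio_deviations (fib (Suc n))"
    and rx: "y < real r * x" "real r * x < y + golden_ratio"
    using mult_golden_ratio_deviations_fib_gap[of "real r" n y] assms by auto
  then obtain a b where x_eq: "x = of_int b - golden_ratio * real a" and "a < fib (Suc n)"
    unfolding golden_ratio_deviations_def by blast
  define u k where "u = s' + r * a" and "k = t + int r * b"
  have "of_int k - golden_ratio * real u = real r * x - y - 1"
    by (simp add: u_def k_def x_eq y_def algebra_simps)
  then have "- 1 < of_int k - golden_ratio * real u"
    "of_int k - golden_ratio * real u < golden_ratio - 1"
    using rx by simp_all
  then have "0 \<le> k" and G_eq: "hofstadter_G (nat k) = u"
    by (rule hofstadter_G_nat_eqI)+
  have "u < r * Suc a"
    using \<open>s' < r\<close> by (simp add: u_def)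
  also have "\<dots> \<le> r * fib (Suc n)"
    using \<open>a < fib (Suc n)\<close> by (intro mult_left_mono) auto
  finally have "u < r * fib (Suc n)" .
  moreover have "[int u = s] (mod int r)" "[int (nat k) = t] (mod int r)"
    using \<open>0 \<le> k\<close> by (simp_all add: u_def s'_eq k_def cong_def)
  ultimately show ?thesis
    using G_eq by blast
qed

lemma hofstadter_G_pair_both_dvd:
  fixes s t :: int
  assumes "r > 0" "n > 0" "real r < golden_ratio ^ n"
    and "int r dvd s" "int r dvd t"
  shows "\<exists>u v. hofstadter_G_pair u v \<and> [int u = s] (mod int r) \<and> [int v = t] (mod int r) \<and>
           v + 2 \<le> fib (2 * n + 2)"
proof -
  define m where "m = (if odd n then n else Suc n)"
  have "golden_ratio ^ n \<le> golden_ratio ^ m"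
    using golden_ratio_bounds by (intro power_increasing) (auto simp: m_def)
  then have "hofstadter_G (r * fib (Suc m)) = r * fib m"
    using assms by (intro hofstadter_G_mult_fib) (auto simp: m_def)
  then have "hofstadter_G_pair (r * fib m) (r * fib (Suc m))"
    using assms by (simp add: hofstadter_G_pair_def fib_neq_0_nat m_def)
  moreover have "r * fib (Suc m) + 2 \<le> fib (2 * n + 2)"
  proof (cases "odd n")
    case True
    have "r * fib (Suc m) < r * fib (n + 2)"
      using assms True by (simp add: m_def fib_neq_0_nat)
    then show ?thesis
      using mult_fib_less_if_odd[OF True assms(3)] by linarith
  next
    case False
    then show ?thesis
      using mult_fib_add_2_le_if_even[of n r] assms by (simp add: m_def)
  qed
  moreover have "[int (r * fib m) = s] (mod int r)" "[int (r * fib (Suc m)) = t] (mod int r)"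
    using assms(4,5) by (simp_all add: cong_def)
  ultimately show ?thesis
    by blast
qed

lemma hofstadter_G_pair_not_both_dvd:
  fixes s t :: int
  assumes "r > 0" "n > 0" "real r < golden_ratio ^ n"
    and "\<not> (int r dvd s \<and> int r dvd t)"
  shows "\<exists>u v. hofstadter_G_pair u v \<and> [int u = s] (mod int r) \<and> [int v = t] (mod int r) \<and>
           v + 2 \<le> fib (2 * n + 2)"
proof -
  obtain v where residues: "[int (hofstadter_G v) = s] (mod int r)" "[int v = t] (mod int r)"
    and G_less: "hofstadter_G v < r * fib (Suc n)"
    using hofstadter_G_residues assms by blast
  have "real r < golden_ratio ^ Suc n"
    using assms(3) golden_ratio_bounds by (elim less_le_trans) (intro power_increasing, simp_all)
  then have "v < r * fib (n + 2)"
    using less_mult_fib_if_hofstadter_G_less[OF G_less] by simp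
  moreover have "r * fib (n + 2) < fib (2 * n + 2)"
    using mult_fib_less_fib assms by blast
  ultimately have "v + 2 \<le> fib (2 * n + 2)"
    by linarith
  moreover have "0 < v"
  proof (rule ccontr)
    assume "\<not> 0 < v"
    then have "hofstadter_G v = 0" "v = 0"
      using hofstadter_G_pos_iff[of v] by simp_all
    then show False
      using residues assms(4) by (simp add: cong_0_iff cong_sym_eq[of 0])
  qed
  then have "hofstadter_G_pair (hofstadter_G v) v"
    by (simp add: hofstadter_G_pair_def hofstadter_G_pos_iff)
  ultimately show ?thesis
    using residues by blast
qed

theorem theorem2:
  fixes r h :: nat and s t :: int
  assumes "r > 0"
    and "0 \<le> s" "s \<le> int r - 1"
    and "0 \<le> t" "t \<le> int r - 1"
    and "h > 0"
    and "real r < golden_ratio ^ h"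
  shows "\<exists>u v :: nat. hofstadter_G_pair u v \<and> [int u = s] (mod int r) \<and>
           [int v = t] (mod int r) \<and> int v \<le> int (fib (2 * h + 2)) - 2"
proof -
  obtain u v where "hofstadter_G_pair u v" "[int u = s] (mod int r)" "[int v = t] (mod int r)"
    and "v + 2 \<le> fib (2 * h + 2)"
    using hofstadter_G_pair_both_dvd[of r h s t] hofstadter_G_pair_not_both_dvd[of r h s t] assms
    by blast
  moreover from this have "int v \<le> int (fib (2 * h + 2)) - 2"
    by linarith
  ultimately show ?thesis
    by blast
qed

end
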